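(* Let $f=(f_1,\dots,f_g):\mathbb{R}^n\times\mathbb{R}^m\to\mathbb{R}^g$ be continuously differentiable in the box $\mathbf{\Omega}=\mathcal{X}\times\mathcal{U}\subset\mathbb{R}^n\times\mathbb{R}^m$, and let $G\in\mathbb{R}^{n\times g}$. Then $f$ is one-sided Lipschitz in $\mathbf{\Omega}$: for all $(x,u),(\hat x,u)\in\mathbf{\Omega}$ $$\langle G(f(x,u)-f(\hat x,u)),\,x-\hat x\rangle\le\gamma_s\,\|x-\hat x\|_2^2,$$ with $$\gamma_s=\Bigg(\max_{(x,u)\in\mathbf{\Omega}}\ \sum_{i=1}^{n}\sum_{j=1}^{n}\Bigg|\sum_{k=1}^{g}G_{(i,k)}\frac{\partial f_k}{\partial x_j}(x,u)\Bigg|^2\Bigg)^{1/2}.$$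
   Context: Standing assumptions: $\mathcal{X}\subset\mathbb{R}^n$ and $\mathcal{U}\subset\mathbb{R}^m$, and $\mathbf{\Omega}=\mathcal{X}\times\mathcal{U}$ is a nonempty box, i.e. a product of $n+m$ compact intervals $[\underline{\omega}_i,\overline{\omega}_i]$ with $\underline{\omega}_i,\overline{\omega}_i\in\mathbb{R}$; $f$ is of class $C^1$ in $\mathbf{\Omega}$ (differentiable at the points of $\mathbf{\Omega}$ with partial derivatives continuous on $\mathbf{\Omega}$). $\partial f_k/\partial x_j$ is the partial derivative with respect to the $j$-th coordinate of the first argument $x\in\mathbb{R}^n$. $G_{(i,k)}$ is the $(i,k)$ entry of $G$; $\langle\cdot,\cdot\rangle$ and $\|\cdot\|_2$ are the Euclidean inner product and norm. *)

theory Defs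
  imports "HOL-Analysis.Analysis"
begin

definition partial_x ::
  "((real^'n) \<times> (real^'m) \<Rightarrow> real^'g) \<Rightarrow> 'g \<Rightarrow> 'n \<Rightarrow> (real^'n) \<times> (real^'m) \<Rightarrow> real" where
  "partial_x f k j z = deriv (\<lambda>t. f (fst z + t *\<^sub>R axis j 1, snd z) $ k) 0"

definition partial_u ::
  "((real^'n) \<times> (real^'m) \<Rightarrow> real^'g) \<Rightarrow> 'g \<Rightarrow> 'm \<Rightarrow> (real^'n) \<times> (real^'m) \<Rightarrow> real" where
  "partial_u f k j z = deriv (\<lambda>t. f (fst z, snd z + t *\<^sub>R axis j 1) $ k) 0"

(* Differentiability is required in the ambient space, also at boundary points of
   S; the partial derivatives are continuous relative to S. *)
definition C1_in ::
  "((real^'n) \<times> (real^'m) \<Rightarrow> real^'g) \<Rightarrow> ((real^'n) \<times> (real^'m)) set \<Rightarrow> bool" where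
  "C1_in f S \<longleftrightarrow>
     (\<forall>z\<in>S. f differentiable (at z)) \<and>
     (\<forall>k j. continuous_on S (partial_x f k j)) \<and>
     (\<forall>k j. continuous_on S (partial_u f k j))"

(* A matrix in real^'g^'n has n rows and g columns, and G $ i $ k is its (i,k) entry. *)
definition osl_sum ::
  "real^'g^'n \<Rightarrow> ((real^'n) \<times> (real^'m) \<Rightarrow> real^'g) \<Rightarrow> (real^'n) \<times> (real^'m) \<Rightarrow> real" where
  "osl_sum G f z = (\<Sum>i\<in>UNIV. \<Sum>j\<in>UNIV. \<bar>\<Sum>k\<in>UNIV. G $ i $ k * partial_x f k j z\<bar>\<^sup>2)"

(* GREATEST is the maximum when one exists and is unspecified otherwise. *)
definition osl_const ::
  "real^'g^'n \<Rightarrow> ((real^'n) \<times> (real^'m) \<Rightarrow> real^'g) \<Rightarrow> ((real^'n) \<times> (real^'m)) set \<Rightarrow> real" where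
  "osl_const G f S = sqrt (GREATEST v. v \<in> osl_sum G f ` S)"

definition one_sided_lipschitz_in ::
  "real^'g^'n \<Rightarrow> ((real^'n) \<times> (real^'m) \<Rightarrow> real^'g) \<Rightarrow> ((real^'n) \<times> (real^'m)) set \<Rightarrow> real \<Rightarrow> bool" where
  "one_sided_lipschitz_in G f S \<gamma> \<longleftrightarrow>
     (\<forall>x x' u. (x, u) \<in> S \<longrightarrow> (x', u) \<in> S \<longrightarrow>
        inner (G *v (f (x, u) - f (x', u))) (x - x') \<le> \<gamma> * (norm (x - x'))\<^sup>2)"

end

theory Submission
  imports Defs
begin

text \<open>
  Along the segment from \<open>x'\<close> to \<open>x\<close> the map \<open>t \<mapsto> \<langle>G f(x' + t(x - x'), u), x - x'\<rangle>\<close> has derivative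
  \<open>\<langle>A (x - x'), x - x'\<rangle>\<close>, where \<open>A\<close> is \<open>G\<close> times the Jacobian in the first argument. The mean value
  theorem and the bound of this quadratic form by the Frobenius norm of \<open>A\<close>, whose square is
  \<open>osl_sum\<close>, give the estimate; the box is used only through convexity and compactness.
\<close>

text \<open>The quadratic form is the entrywise inner product of \<open>A\<close> with the rank-one
  matrix \<open>B\<close> = v v^T, so Cauchy-Schwarz for matrices applies; \<open>norm A\<close> is
  the Frobenius norm.\<close>

lemma quadratic_form_le_norm:
  fixes A :: "real^'n^'n"
  shows "(A *v v) \<bullet> v \<le> norm A * (norm v)\<^sup>2"
proof -
  define B where "B = (\<chi> i. v $ i *\<^sub>R v)"
  have "(A *v v) \<bullet> v = A \<bullet> B"
    by (simp add: B_def inner_vec_def matrix_vector_mult_def sum_distrib_right sum_distrib_left mult_ac)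
  also have "\<dots> \<le> norm A * norm B"
    by (rule norm_cauchy_schwarz)
  \<comment> \<open>Row \<open>i\<close> of \<open>B\<close> is a multiple of \<open>v\<close> and
    contributes its squared length; these sum to the fourth power of \<open>norm v\<close>.\<close>
  also have "norm B = sqrt (\<Sum>i\<in>UNIV. (v $ i)\<^sup>2 * (v \<bullet> v))"
    by (simp add: B_def norm_eq_sqrt_inner inner_vec_def[of "\<chi> i. _ i"] power2_eq_square mult_ac)
  also have "\<dots> = (norm v)\<^sup>2"
    unfolding sum_distrib_right[symmetric] power2_norm_eq_inner
    by (simp add: inner_vec_def power2_eq_square sum_nonneg)
  finally show ?thesis .
qed

text \<open>Assembled from \<open>partial_x\<close> rather than from a Frechet derivative, so that
  the entries of \<open>G ** jacobian_x f z\<close> are exactly the inner sums of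
  \<open>osl_sum\<close>.\<close>

definition jacobian_x ::
  "((real^'n) \<times> (real^'m) \<Rightarrow> real^'g) \<Rightarrow> (real^'n) \<times> (real^'m) \<Rightarrow> real^'n^'g" where
  "jacobian_x f z = (\<chi> k j. partial_x f k j z)"

lemma osl_sum_eq_norm: "osl_sum G f z = (norm (G ** jacobian_x f z))\<^sup>2"
  unfolding power2_norm_eq_inner
  by (simp add: osl_sum_def jacobian_x_def matrix_matrix_mult_def inner_vec_def power2_eq_square)

text \<open>By the chain rule along a coordinate line, \<open>D\<close> maps each
  \<open>x\<close>-axis vector to a column of partial derivatives; linearity extends this to all
  \<open>v\<close>.\<close>

lemma frechet_derivative_fst_eq_jacobian_x:
  fixes f :: "(real^'n) \<times> (real^'m) \<Rightarrow> real^'g"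
  assumes "(f has_derivative D) (at z)"
  shows "D (v, 0) = jacobian_x f z *v v"
proof -
  interpret D: bounded_linear D
    using assms by (rule has_derivative_bounded_linear)
  have partial: "D (axis j 1, 0) $ k = partial_x f k j z" for j k
  proof -
    have "((\<lambda>t. f (z + t *\<^sub>R (axis j 1, 0)) $ k) has_derivative (\<lambda>t. D (t *\<^sub>R (axis j 1, 0)) $ k)) (at 0)"
      by (rule bounded_linear.has_derivative[OF bounded_linear_vec_nth],
          rule has_derivative_compose[where g = f])
         (auto intro!: derivative_eq_intros simp: assms simp flip: zero_prod_def)
    then have "((\<lambda>t. f (z + t *\<^sub>R (axis j 1, 0)) $ k) has_real_derivative D (axis j 1, 0) $ k) (at 0)"
      by (simp only: has_field_derivative_def D.scaleR vector_scaleR_component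
          real_scaleR_def mult_commute_abs)
    then show ?thesis
      by (cases z) (simp add: partial_x_def DERIV_imp_deriv)
  qed
  have "(v, 0) = (\<Sum>j\<in>UNIV. v $ j *\<^sub>R (axis j 1, 0 :: real^'m))"
    by (rule prod_eqI) (simp_all add: fst_sum snd_sum basis_expansion scalar_mult_eq_scaleR[symmetric])
  then have "D (v, 0) = (\<Sum>j\<in>UNIV. v $ j *\<^sub>R D (axis j 1, 0))"
    by (simp only: D.sum D.scaleR)
  then show ?thesis
    by (simp add: vec_eq_iff partial jacobian_x_def matrix_vector_mult_def mult.commute)
qed

text \<open>Both points share \<open>u\<close>, so the segment between them moves only in
  \<open>x\<close>, and convexity keeps it in \<open>S\<close>. Any uniform bound \<gamma> will do
  here; the maximum enters only afterwards.\<close>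

lemma one_sided_lipschitz_in_convex:
  fixes f :: "(real^'n) \<times> (real^'m) \<Rightarrow> real^'g"
  assumes "convex S" and diff: "\<And>z. z \<in> S \<Longrightarrow> f differentiable (at z)"
    and bound: "\<And>z. z \<in> S \<Longrightarrow> norm (G ** jacobian_x f z) \<le> \<gamma>"
  shows "one_sided_lipschitz_in G f S \<gamma>"
  unfolding one_sided_lipschitz_in_def
proof (intro allI impI)
  fix x x' u assume S: "(x, u) \<in> S" "(x', u) \<in> S"
  define v where "v = x - x'"
  define p where "p = (\<lambda>t. (x', u) + t *\<^sub>R (v, 0 :: real^'m))"
  have p_mem: "p t \<in> S" if "0 \<le> t" "t \<le> 1" for t
  proof -
    have "p t = (1 - t) *\<^sub>R (x', u) + t *\<^sub>R (x, u)"
      by (simp add: p_def v_def algebra_simps)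
    then show ?thesis
      using convexD_alt[OF \<open>convex S\<close> S(2) S(1)] that by simp
  qed
  define \<phi> where "\<phi> = (\<lambda>t. (G *v f (p t)) \<bullet> v)"
  \<comment> \<open>The derivative is two-sided even at the endpoints of the segment, because
    \<open>f\<close> is differentiable in the ambient space at every point of
    \<open>S\<close>.\<close>
  have deriv: "(\<phi> has_real_derivative ((G ** jacobian_x f (p t)) *v v) \<bullet> v) (at t)"
    if t: "0 \<le> t" "t \<le> 1" for t
  proof -
    obtain D where D: "(f has_derivative D) (at (p t))"
      using diff[OF p_mem[OF t]] by (auto simp: differentiable_def)
    have "(p has_derivative (\<lambda>s. s *\<^sub>R (v, 0))) (at t)"
      unfolding p_def by (auto intro!: derivative_eq_intros)
    from has_derivative_compose[OF this D]
    have "((\<lambda>s. (G *v f (p s)) \<bullet> v) has_derivative (\<lambda>s. (G *v D (s *\<^sub>R (v, 0))) \<bullet> v)) (at t)"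
      by (intro has_derivative_inner_left
          bounded_linear.has_derivative[OF matrix_vector_mul_bounded_linear])
    moreover have "D (s *\<^sub>R (v, 0)) = s *\<^sub>R (jacobian_x f (p t) *v v)" for s
      using bounded_linear.linear[OF has_derivative_bounded_linear[OF D]]
      by (simp only: linear_scale frechet_derivative_fst_eq_jacobian_x[OF D])
    ultimately show ?thesis
      by (simp add: \<phi>_def has_field_derivative_def matrix_vector_mult_scaleR
          matrix_vector_mul_assoc mult_commute_abs)
  qed
  obtain t where t: "0 < t" "t < 1"
    and eq: "\<phi> 1 - \<phi> 0 = ((G ** jacobian_x f (p t)) *v v) \<bullet> v"
    using MVT2[of 0 1 \<phi> "\<lambda>t. ((G ** jacobian_x f (p t)) *v v) \<bullet> v"] deriv by auto
  have "(G *v (f (x, u) - f (x', u))) \<bullet> (x - x') = \<phi> 1 - \<phi> 0"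
    by (simp add: \<phi>_def p_def v_def matrix_vector_mult_diff_distrib inner_diff_left)
  also have "\<dots> \<le> norm (G ** jacobian_x f (p t)) * (norm v)\<^sup>2"
    unfolding eq by (rule quadratic_form_le_norm)
  also have "\<dots> \<le> \<gamma> * (norm v)\<^sup>2"
    using t by (intro mult_right_mono bound p_mem) auto
  finally show "(G *v (f (x, u) - f (x', u))) \<bullet> (x - x') \<le> \<gamma> * (norm (x - x'))\<^sup>2"
    by (simp add: v_def)
qed

theorem theorem2:
  fixes f :: "(real^'n) \<times> (real^'m) \<Rightarrow> real^'g"
    and G :: "real^'g^'n"
    and X :: "(real^'n) set" and U :: "(real^'m) set"
    and xl xu :: "real^'n" and ul uu :: "real^'m"
  assumes "X = cbox xl xu" and "U = cbox ul uu"
    and "X \<times> U \<noteq> {}"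
    and "C1_in f (X \<times> U)"
  shows "(\<exists>z\<in>X \<times> U. \<forall>w\<in>X \<times> U. osl_sum G f w \<le> osl_sum G f z)
    \<and> one_sided_lipschitz_in G f (X \<times> U) (osl_const G f (X \<times> U))"
proof -
  have "compact (X \<times> U)" "convex (X \<times> U)"
    using assms(1,2) by (auto intro: compact_Times convex_Times)
  moreover have "continuous_on (X \<times> U) (osl_sum G f)"
    using assms(4) unfolding C1_in_def osl_sum_def
    by (intro continuous_intros) auto
  ultimately obtain z where z: "z \<in> X \<times> U" "\<forall>w\<in>X \<times> U. osl_sum G f w \<le> osl_sum G f z"
    using continuous_attains_sup assms(3) by metis
  \<comment> \<open>Since the maximum is attained at \<open>z\<close>, \<open>GREATEST\<close>
    denotes it and is not an unspecified value.\<close>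
  then have "(GREATEST v. v \<in> osl_sum G f ` (X \<times> U)) = osl_sum G f z"
    by (intro Greatest_equality) auto
  then have const: "osl_const G f (X \<times> U) = sqrt (osl_sum G f z)"
    by (simp add: osl_const_def)
  have "one_sided_lipschitz_in G f (X \<times> U) (osl_const G f (X \<times> U))"
  proof (rule one_sided_lipschitz_in_convex[OF \<open>convex (X \<times> U)\<close>])
    show "f differentiable (at w)" if "w \<in> X \<times> U" for w
      using assms(4) that by (auto simp: C1_in_def)
    show "norm (G ** jacobian_x f w) \<le> osl_const G f (X \<times> U)" if "w \<in> X \<times> U" for w
      \<comment> \<open>Squaring reduces the goal to
        \<open>osl_sum G f w \<le> osl_sum G f z\<close>, the maximality of
        \<open>z\<close>.\<close>
      unfolding const using z(2) that by (intro real_le_rsqrt) (auto simp flip: osl_sum_eq_norm)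
  qed
  with z show ?thesis by blast
qed

end
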